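(* Let $G$ be a concurrent stochastic game and let $U^\star=\lim_{k\to\infty}U^k$ be the limit of the naive upper-bound iteration $U^{k+1}=B(U^k)$ starting from $U^0$. If value iteration from above does not converge to the value in the limit, i.e. $U^\star(s)>V(s)$ for some state $s$ (with $U^\star\ge V$), then $G$ contains a bloated end component $X\subseteq S\setminus(T\cup W)$ with respect to the valuation $U^\star$.
   Context: A concurrent stochastic game (CSG) is a tuple $G=(S,A_1,A_2,\Gamma_1,\Gamma_2,\delta,s_0,T)$: $S$ is a finite set of states; $A_1,A_2$ are finite action sets of Player 1 (reachability player) and Player 2 (safety player); $\Gamma_i:S\to 2^{A_i}\setminus\{\emptyset\}$ gives the enabled actions; $\delta:S\times A_1\times A_2\to\mathcal D(S)$ is the transition function; $s_0\in S$; $T\subseteq S$ is the target set. A (memoryless) strategy of Player 1 maps each $s$ to a distribution on $A_1$ supported in $\Gamma_1(s)$; similarly for Player 2. A pair $(\rho,\sigma)$ induces a Markov chain and measures $\mathbb P^{\rho,\sigma}_s$. The value is $V(s)=\sup_\rho\inf_\sigma\mathbb P^{\rho,\sigma}_s(\Diamond T)$ ($\Diamond T$: plays visiting $T$). Let $W=\{s: V(s)=0\}$. The paper assumes throughout (w.l.o.g.) that $T$ and $W$ are singletons and absorbing. Local strategies at $s$: $\Pi_1(s)$, $\Pi_2(s)$ are the distributions on $\Gamma_1(s)$, $\Gamma_2(s)$. $\mathrm{Post}(s,\rho,\sigma)=\bigcup_{a\in\mathrm{supp}\rho,b\in\mathrm{supp}\sigma}\mathrm{supp}\,\delta(s,a,b)$.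 A valuation is $v:S\to[0,1]$, ordered pointwise. Bellman operator: $B(v)(s,\rho,\sigma)=\sum_{a,b}\sum_{s'}\rho(a)\sigma(b)\delta(s,a,b)(s')v(s')$, $B(v)(s)=\sup_{\rho\in\Pi_1(s)}\inf_{\sigma\in\Pi_2(s)}B(v)(s,\rho,\sigma)$. $U^0(s)=0$ if $s\in W$ and $1$ otherwise. End component (EC): nonempty $X\subseteq S$ such that there are local strategies $\rho_s,\sigma_s$ ($s\in X$) with $\mathrm{Post}(s,\rho_s,\sigma_s)\subseteq X$ for all $s\in X$ and any two states of $X$ are connected by a path in $X$ following these successors. $(s,\rho,\sigma)$ leaves $X$ if $\mathrm{Post}(s,\rho,\sigma)\not\subseteq X$. $R_L(X,s)$: the $\rho\in\Pi_1(s)$ such that $(s,\rho,\sigma)$ leaves $X$ for every $\sigma\in\Pi_2(s)$; $R_{\bar L}(X,s)=\Pi_1(s)\setminus R_L(X,s)$. Dominance: for $P_1,P_2\subseteq\Pi_1(s)$, $Q\subseteq\Pi_2(s)$, $P_2\preceq_{v,Q}P_1$ iff $\exists\rho_1\in P_1\,\forall\rho_2\in P_2$: (i) $\inf_{\sigma\in Q}B(v)(s,\rho_2,\sigma)\le\inf_{\sigma\in Q}B(v)(s,\rho_1,\sigma)$; $P_2\prec_{v,Q}P_1$ iff $\exists\rho_1\in P_1\,\forall\rho_2\in P_2$: (i) and (ii) $\exists\sigma'\in Q$: $B(v)(s,\rho_2,\sigma')<B(v)(s,\rho_1,\sigma')$. Hazardous: for $X\subseteq S\setminus(T\cup W)$,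 $s\in X$, $\rho\in\Pi_1(s)$ is hazardous w.r.t. $v$ iff (i) $\rho\in R_{\bar L}(X,s)$, (ii) $\Pi_1(s)\setminus\{\rho\}\preceq_{v,\Pi_2(s)}\{\rho\}$, (iii) $R_L(X,s)\prec_{v,\Pi_2(s)}\{\rho\}$; set $\mathrm{Hazard}_v(X,s)$. An EC $X\subseteq S\setminus(T\cup W)$ is a bloated end component (BEC) w.r.t. $v$ iff $\mathrm{Hazard}_v(X,s)\ne\emptyset$ for all $s\in X$. *)

theory Defs
  imports "HOL-Probability.Probability"
begin

text \<open>
  The state space and the two action sets of a game are the finite types \<open>'s\<close>, \<open>'a\<close> and \<open>'b\<close>.
  The transition function is total; its values at disabled actions are irrelevant.
\<close>

record ('s, 'a, 'b) csg =
  act1 :: "'s \<Rightarrow> 'a set"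
  act2 :: "'s \<Rightarrow> 'b set"
  trans_prob :: "'s \<Rightarrow> 'a \<Rightarrow> 'b \<Rightarrow> 's pmf"
  init_state :: 's
  target :: "'s set"

definition is_csg :: "('s::finite, 'a::finite, 'b::finite) csg \<Rightarrow> bool" where
  "is_csg G \<longleftrightarrow> (\<forall>s. act1 G s \<noteq> {} \<and> act2 G s \<noteq> {})"


subsection \<open>Strategies and the induced Markov chain\<close>

definition local1 :: "('s, 'a, 'b) csg \<Rightarrow> 's \<Rightarrow> 'a pmf set" where
  "local1 G s = {\<rho>. set_pmf \<rho> \<subseteq> act1 G s}"

definition local2 :: "('s, 'a, 'b) csg \<Rightarrow> 's \<Rightarrow> 'b pmf set" where
  "local2 G s = {\<sigma>. set_pmf \<sigma> \<subseteq> act2 G s}"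

definition strategies1 :: "('s, 'a, 'b) csg \<Rightarrow> ('s \<Rightarrow> 'a pmf) set" where
  "strategies1 G = {\<rho>. \<forall>s. \<rho> s \<in> local1 G s}"

definition strategies2 :: "('s, 'a, 'b) csg \<Rightarrow> ('s \<Rightarrow> 'b pmf) set" where
  "strategies2 G = {\<sigma>. \<forall>s. \<sigma> s \<in> local2 G s}"

definition step_pmf ::
  "('s, 'a, 'b) csg \<Rightarrow> ('s \<Rightarrow> 'a pmf) \<Rightarrow> ('s \<Rightarrow> 'b pmf) \<Rightarrow> 's \<Rightarrow> 's pmf" where
  "step_pmf G \<rho> \<sigma> s =
     bind_pmf (\<rho> s) (\<lambda>a. bind_pmf (\<sigma> s) (\<lambda>b. trans_prob G s a b))"

text \<open>
  The law of a Markov chain with kernel \<open>K\<close> started in \<open>s\<close>, on infinite plays \<open>\<omega> :: nat \<Rightarrow> 's\<close>,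
  is the Ionescu-Tulcea measure in which \<open>\<omega> 0 = s\<close> and \<open>\<omega> (Suc n)\<close> has the
  conditional distribution \<open>K (\<omega> n)\<close>.
\<close>

definition chain_kernel :: "('s \<Rightarrow> 's pmf) \<Rightarrow> 's \<Rightarrow> nat \<Rightarrow> (nat \<Rightarrow> 's) \<Rightarrow> 's measure" where
  "chain_kernel K s n \<omega> =
     measure_pmf (case n of 0 \<Rightarrow> return_pmf s | Suc m \<Rightarrow> K (\<omega> m))"

lemma Ionescu_Tulcea_chain_kernel:
  fixes K :: "'s::finite \<Rightarrow> 's pmf"
  shows "Ionescu_Tulcea (chain_kernel K s) (\<lambda>_. count_space UNIV)"
proof (rule Ionescu_Tulcea.intro)
  fix n :: nat
  show "chain_kernel K s n
      \<in> measurable (PiM {0..<n} (\<lambda>_. count_space UNIV)) (subprob_algebra (count_space UNIV))"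
  proof (cases n)
    case 0
    then show ?thesis
      by (auto simp: chain_kernel_def[abs_def] intro!: measurable_const measure_pmf_in_subprob_algebra)
  next
    case (Suc m)
    have "(\<lambda>\<omega>. \<omega> m) \<in> measurable (PiM {0..<Suc m} (\<lambda>_. count_space (UNIV :: 's set))) (count_space UNIV)"
      by (rule measurable_component_singleton) simp
    moreover have "(\<lambda>x. measure_pmf (K x)) \<in> measurable (count_space UNIV) (subprob_algebra (count_space UNIV))"
      by (auto intro!: measure_pmf_in_subprob_algebra)
    ultimately have "(\<lambda>\<omega>. measure_pmf (K (\<omega> m)))
      \<in> measurable (PiM {0..<Suc m} (\<lambda>_. count_space (UNIV :: 's set))) (subprob_algebra (count_space UNIV))"
      by (rule measurable_compose)
    then show ?thesis
      by (simp add: Suc chain_kernel_def[abs_def])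
  qed
next
  fix n and \<omega> :: "nat \<Rightarrow> 's"
  show "prob_space (chain_kernel K s n \<omega>)"
    by (simp add: chain_kernel_def measure_pmf.prob_space_axioms)
qed

definition path_measure :: "('s \<Rightarrow> 's pmf) \<Rightarrow> 's \<Rightarrow> (nat \<Rightarrow> 's) measure" where
  "path_measure K s =
     projective_family.lim UNIV (Ionescu_Tulcea.CI (chain_kernel K s) (\<lambda>_. count_space UNIV))
       (\<lambda>_. count_space UNIV)"

definition reach_prob ::
  "('s, 'a, 'b) csg \<Rightarrow> ('s \<Rightarrow> 'a pmf) \<Rightarrow> ('s \<Rightarrow> 'b pmf) \<Rightarrow> 's \<Rightarrow> real" where
  "reach_prob G \<rho> \<sigma> s =
     measure (path_measure (step_pmf G \<rho> \<sigma>) s) {\<omega>. \<exists>n. \<omega> n \<in> target G}"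

definition val :: "('s, 'a, 'b) csg \<Rightarrow> 's \<Rightarrow> real" where
  "val G s = (SUP \<rho>\<in>strategies1 G. INF \<sigma>\<in>strategies2 G. reach_prob G \<rho> \<sigma> s)"

definition zero_states :: "('s, 'a, 'b) csg \<Rightarrow> 's set" where
  "zero_states G = {s. val G s = 0}"

definition absorbing :: "('s, 'a, 'b) csg \<Rightarrow> 's \<Rightarrow> bool" where
  "absorbing G s \<longleftrightarrow> (\<forall>a\<in>act1 G s. \<forall>b\<in>act2 G s. trans_prob G s a b = return_pmf s)"

text \<open>The standing normal form: the target set and the set of value-zero states are absorbing singletons.\<close>

definition normal_form :: "('s, 'a, 'b) csg \<Rightarrow> bool" where
  "normal_form G \<longleftrightarrow>
     (\<exists>t. target G = {t} \<and> absorbing G t) \<and> (\<exists>w. zero_states G = {w} \<and> absorbing G w)"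


subsection \<open>Bellman operator and value iteration from above\<close>

definition bellman_at ::
  "('s::finite, 'a::finite, 'b::finite) csg \<Rightarrow> ('s \<Rightarrow> real) \<Rightarrow> 's \<Rightarrow> 'a pmf \<Rightarrow> 'b pmf \<Rightarrow> real" where
  "bellman_at G v s \<rho> \<sigma> =
     (\<Sum>a\<in>UNIV. \<Sum>b\<in>UNIV. \<Sum>s'\<in>UNIV. pmf \<rho> a * pmf \<sigma> b * pmf (trans_prob G s a b) s' * v s')"

definition bellman ::
  "('s::finite, 'a::finite, 'b::finite) csg \<Rightarrow> ('s \<Rightarrow> real) \<Rightarrow> 's \<Rightarrow> real" where
  "bellman G v s = (SUP \<rho>\<in>local1 G s. INF \<sigma>\<in>local2 G s. bellman_at G v s \<rho> \<sigma>)"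

primrec upper_iter :: "('s::finite, 'a::finite, 'b::finite) csg \<Rightarrow> nat \<Rightarrow> 's \<Rightarrow> real" where
  "upper_iter G 0 = (\<lambda>s. if s \<in> zero_states G then 0 else 1)"
| "upper_iter G (Suc k) = bellman G (upper_iter G k)"

definition upper_limit :: "('s::finite, 'a::finite, 'b::finite) csg \<Rightarrow> 's \<Rightarrow> real" where
  "upper_limit G s = lim (\<lambda>k. upper_iter G k s)"


subsection \<open>End components\<close>

definition Post :: "('s, 'a, 'b) csg \<Rightarrow> 's \<Rightarrow> 'a pmf \<Rightarrow> 'b pmf \<Rightarrow> 's set" where
  "Post G s \<rho> \<sigma> = (\<Union>a\<in>set_pmf \<rho>. \<Union>b\<in>set_pmf \<sigma>. set_pmf (trans_prob G s a b))"

definition end_component :: "('s, 'a, 'b) csg \<Rightarrow> 's set \<Rightarrow> bool" where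
  "end_component G X \<longleftrightarrow> X \<noteq> {} \<and>
     (\<exists>\<rho> \<sigma>. (\<forall>s\<in>X. \<rho> s \<in> local1 G s \<and> \<sigma> s \<in> local2 G s \<and> Post G s (\<rho> s) (\<sigma> s) \<subseteq> X) \<and>
       (\<forall>s\<in>X. \<forall>t\<in>X. (s, t) \<in> {(u, u'). u \<in> X \<and> u' \<in> X \<and> u' \<in> Post G u (\<rho> u) (\<sigma> u)}\<^sup>*))"


subsection \<open>Hazardous strategies and bloated end components\<close>

definition leaves :: "('s, 'a, 'b) csg \<Rightarrow> 's set \<Rightarrow> 's \<Rightarrow> 'a pmf \<Rightarrow> 'b pmf \<Rightarrow> bool" where
  "leaves G X s \<rho> \<sigma> \<longleftrightarrow> \<not> Post G s \<rho> \<sigma> \<subseteq> X"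

definition leaving :: "('s, 'a, 'b) csg \<Rightarrow> 's set \<Rightarrow> 's \<Rightarrow> 'a pmf set" where
  "leaving G X s = {\<rho> \<in> local1 G s. \<forall>\<sigma>\<in>local2 G s. leaves G X s \<rho> \<sigma>}"

definition non_leaving :: "('s, 'a, 'b) csg \<Rightarrow> 's set \<Rightarrow> 's \<Rightarrow> 'a pmf set" where
  "non_leaving G X s = local1 G s - leaving G X s"

definition weakly_dominated ::
  "('s::finite, 'a::finite, 'b::finite) csg \<Rightarrow> ('s \<Rightarrow> real) \<Rightarrow> 's \<Rightarrow> 'b pmf set
     \<Rightarrow> 'a pmf set \<Rightarrow> 'a pmf set \<Rightarrow> bool" where
  "weakly_dominated G v s Q P2 P1 \<longleftrightarrow> (\<exists>\<rho>1\<in>P1. \<forall>\<rho>2\<in>P2.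
     (INF \<sigma>\<in>Q. bellman_at G v s \<rho>2 \<sigma>) \<le> (INF \<sigma>\<in>Q. bellman_at G v s \<rho>1 \<sigma>))"

definition strictly_dominated ::
  "('s::finite, 'a::finite, 'b::finite) csg \<Rightarrow> ('s \<Rightarrow> real) \<Rightarrow> 's \<Rightarrow> 'b pmf set
     \<Rightarrow> 'a pmf set \<Rightarrow> 'a pmf set \<Rightarrow> bool" where
  "strictly_dominated G v s Q P2 P1 \<longleftrightarrow> (\<exists>\<rho>1\<in>P1. \<forall>\<rho>2\<in>P2.
     (INF \<sigma>\<in>Q. bellman_at G v s \<rho>2 \<sigma>) \<le> (INF \<sigma>\<in>Q. bellman_at G v s \<rho>1 \<sigma>) \<and>
     (\<exists>\<sigma>'\<in>Q. bellman_at G v s \<rho>2 \<sigma>' < bellman_at G v s \<rho>1 \<sigma>'))"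

definition hazard ::
  "('s::finite, 'a::finite, 'b::finite) csg \<Rightarrow> ('s \<Rightarrow> real) \<Rightarrow> 's set \<Rightarrow> 's \<Rightarrow> 'a pmf set" where
  "hazard G v X s = {\<rho> \<in> local1 G s.
     \<rho> \<in> non_leaving G X s \<and>
     weakly_dominated G v s (local2 G s) (local1 G s - {\<rho>}) {\<rho>} \<and>
     strictly_dominated G v s (local2 G s) (leaving G X s) {\<rho>}}"

definition bloated_end_component ::
  "('s::finite, 'a::finite, 'b::finite) csg \<Rightarrow> ('s \<Rightarrow> real) \<Rightarrow> 's set \<Rightarrow> bool" where
  "bloated_end_component G v X \<longleftrightarrow>
     end_component G X \<and> X \<subseteq> - (target G \<union> zero_states G) \<and> (\<forall>s\<in>X. hazard G v X s \<noteq> {})"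

end

theory Submission
  imports Defs
begin

text \<open>
  Let \<open>U\<close> be the limit from above and \<open>L\<close> the limit of value iteration from below. Discounting yields
  memoryless strategies that are almost optimal, so \<open>L \<le> V\<close>, and hence \<open>m = max (U - L)\<close>
  is positive. Let \<open>Y\<close> be the set of states where \<open>U - L\<close> equals \<open>m\<close>. In every state let \<open>\<rho>\<close> be
  optimal for the one-step game with payoff \<open>U\<close>, of maximal support among the optimal local strategies
  (a mixture of two optimal strategies is optimal), and let \<open>\<sigma>\<close> be a best response to \<open>\<rho>\<close> for the
  payoff \<open>L\<close>. On \<open>Y\<close>, moving by \<open>(\<rho>, \<sigma>)\<close> does not decrease \<open>U\<close> and does not increase \<open>L\<close> in expectation,
  so it stays in \<open>Y\<close>. A bottom strongly connected component \<open>X\<close> of the resulting chain on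
  \<open>Y\<close> is an end component. A local strategy that leaves \<open>X\<close> against every \<open>\<sigma>'\<close> puts weight outside the support
  of \<open>\<rho>\<close>, so it is not optimal, and \<open>\<rho>\<close> is hazardous. No minimax theorem is needed, since \<open>\<sigma>\<close>
  only has to answer this one \<open>\<rho>\<close>.
\<close>

subsection \<open>Coordinates of the path measure\<close>

text \<open>The law of the state after \<open>n\<close> steps. It is a finite-horizon substitute for
  the path measure in all estimates of reachability.\<close>

primrec chain_pmf :: "('s \<Rightarrow> 's pmf) \<Rightarrow> 's \<Rightarrow> nat \<Rightarrow> 's pmf" where
  "chain_pmf K s 0 = return_pmf s"
| "chain_pmf K s (Suc n) = bind_pmf (chain_pmf K s n) K"

text \<open>The recursion appends the last step; this form splits off the first one, as the Bellman
  operator does.\<close>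

lemma chain_pmf_Suc_left:
  "chain_pmf K s (Suc n) = bind_pmf (K s) (\<lambda>s'. chain_pmf K s' n)"
  by (induction n) (simp_all add: bind_return_pmf bind_return_pmf' bind_assoc_pmf)

text \<open>\<open>C 0 (Suc n)\<close> is the joint law of coordinates \<open>0\<close> to
  \<open>n\<close>: kernel number 0 only draws the start state, so \<open>Suc n\<close> kernels
  correspond to \<open>n\<close> moves. Integrating out the last kernel reduces the claim to one
  coordinate less.\<close>

lemma nn_integral_chain_marginal:
  fixes K :: "'s::finite \<Rightarrow> 's pmf" and f :: "'s \<Rightarrow> ennreal"
  shows "(\<integral>\<^sup>+\<omega>. f (\<omega> n) \<partial>Ionescu_Tulcea.C (chain_kernel K s) (\<lambda>_. count_space UNIV) 0 (Suc n) (\<lambda>_. undefined))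
    = (\<integral>\<^sup>+x. f x \<partial>measure_pmf (chain_pmf K s n))"
proof -
  let ?M = "\<lambda>_::nat. count_space (UNIV :: 's set)"
  interpret IT: Ionescu_Tulcea "chain_kernel K s" ?M
    by (rule Ionescu_Tulcea_chain_kernel)
  \<comment> \<open>The empty product has this function as its only point; it is the empty history
    from which the construction starts.\<close>
  have undef: "(\<lambda>_. undefined) \<in> space (PiM {0..<0} ?M)"
    by (simp add: space_PiM)
  have step: "(\<integral>\<^sup>+\<omega>. g (\<omega> n) \<partial>IT.C 0 (Suc n) (\<lambda>_. undefined)) =
      (\<integral>\<^sup>+\<omega>. (\<integral>\<^sup>+x. g x \<partial>chain_kernel K s n \<omega>) \<partial>IT.C 0 n (\<lambda>_. undefined))"
    for n and g :: "'s \<Rightarrow> ennreal"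
  proof -
    have g: "(\<lambda>\<omega>. g (\<omega> n)) \<in> borel_measurable (PiM {0..<Suc n} ?M)"
      by (rule measurable_compose[OF measurable_component_singleton]) auto
    have "(\<integral>\<^sup>+\<omega>. g (\<omega> n) \<partial>IT.C 0 (Suc n) (\<lambda>_. undefined)) =
        (\<integral>\<^sup>+\<omega>. (\<integral>\<^sup>+\<omega>'. g (\<omega>' n) \<partial>IT.eP n \<omega>) \<partial>IT.C 0 n (\<lambda>_. undefined))"
      using IT.measurable_eP[of n] IT.sets_C[OF undef, of n]
      by (simp add: nn_integral_bind[OF g, of "IT.eP n"] cong: measurable_cong_sets)
    also have "\<dots> = (\<integral>\<^sup>+\<omega>. (\<integral>\<^sup>+x. g x \<partial>chain_kernel K s n \<omega>) \<partial>IT.C 0 n (\<lambda>_. undefined))"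
      using IT.space_C[OF undef, of n]
      by (intro nn_integral_cong) (simp add: IT.nn_integral_eP[OF _ g])
    finally show ?thesis .
  qed
  show ?thesis
  proof (induction n arbitrary: f)
    case 0
    show ?case
      unfolding step
      by (simp add: undef chain_kernel_def nn_integral_return)
  next
    case (Suc n)
    have "(\<integral>\<^sup>+\<omega>. f (\<omega> (Suc n)) \<partial>IT.C 0 (Suc (Suc n)) (\<lambda>_. undefined)) =
      (\<integral>\<^sup>+\<omega>. (\<integral>\<^sup>+x. f x \<partial>K (\<omega> n)) \<partial>IT.C 0 (Suc n) (\<lambda>_. undefined))"
      unfolding step[of "Suc n"] by (simp add: chain_kernel_def)
    also have "\<dots> = (\<integral>\<^sup>+y. (\<integral>\<^sup>+x. f x \<partial>K y) \<partial>chain_pmf K s n)"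
      \<comment> \<open>The induction hypothesis is applied to the function sending \<open>y\<close>
        to the integral of \<open>f\<close> under \<open>K y\<close>, hence the generalisation over
        \<open>f\<close>.\<close>
      by (rule Suc.IH)
    finally show ?case
      by (simp add: nn_integral_bind_pmf)
  qed
qed

lemma space_path_measure: "space (path_measure K s) = UNIV"
  for K :: "'s::finite \<Rightarrow> 's pmf"
proof -
  interpret IT: Ionescu_Tulcea "chain_kernel K s" "\<lambda>_. count_space (UNIV :: 's set)"
    by (rule Ionescu_Tulcea_chain_kernel)
  show ?thesis unfolding path_measure_def by (simp add: space_PiM)
qed

lemma sets_path_measure: "sets (path_measure K s) = sets (PiM UNIV (\<lambda>_. count_space UNIV))"
  for K :: "'s::finite \<Rightarrow> 's pmf"
proof -
  interpret IT: Ionescu_Tulcea "chain_kernel K s" "\<lambda>_. count_space (UNIV :: 's set)"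
    by (rule Ionescu_Tulcea_chain_kernel)
  show ?thesis unfolding path_measure_def by simp
qed

lemma sets_path_coordinate: "{\<omega>. \<omega> n \<in> T} \<in> sets (path_measure K s)"
  for K :: "'s::finite \<Rightarrow> 's pmf"
proof -
  have "(\<lambda>\<omega>. \<omega> n) -` T \<inter> space (PiM UNIV (\<lambda>_. count_space (UNIV :: 's set)))
      \<in> sets (PiM UNIV (\<lambda>_. count_space UNIV))"
    by (rule measurable_sets[OF measurable_component_singleton]) auto
  then show ?thesis
    by (simp add: sets_path_measure vimage_def space_PiM)
qed

text \<open>The event is a cylinder over the coordinates \<open>0\<close> to \<open>n\<close>, on
  which the projective limit agrees with the finite product construction.\<close>

lemma emeasure_path_coordinate:
  fixes K :: "'s::finite \<Rightarrow> 's pmf"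
  shows "emeasure (path_measure K s) {\<omega>. \<omega> n \<in> T} = emeasure (chain_pmf K s n) T"
proof -
  let ?M = "\<lambda>_::nat. count_space (UNIV :: 's set)"
  interpret IT: Ionescu_Tulcea "chain_kernel K s" ?M
    by (rule Ionescu_Tulcea_chain_kernel)
  let ?J = "{0..<Suc n}" and ?C = "IT.C 0 (Suc n) (\<lambda>_. undefined)"
  let ?X = "{\<omega> \<in> space (PiM ?J ?M). \<omega> n \<in> T}"
  have X: "?X \<in> sets (PiM ?J ?M)"
  proof -
    have "(\<lambda>\<omega>. \<omega> n) -` T \<inter> space (PiM ?J ?M) \<in> sets (PiM ?J ?M)"
      by (rule measurable_sets[OF measurable_component_singleton]) auto
    then show ?thesis by (simp add: vimage_def Int_def conj_commute)
  qed
  have undef: "(\<lambda>_. undefined) \<in> space (PiM {0..<0} ?M)"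
    by (simp add: space_PiM)
  have emb_UNIV: "IT.PF.emb UNIV ?J ?X = {\<omega>. \<omega> n \<in> T}"
    by (auto simp: prod_emb_def space_PiM)
  have emb_J: "IT.PF.emb ?J ?J ?X = ?X"
    using sets.sets_into_space[OF X] by (intro prod_emb_id) (simp add: space_PiM)
  have "emeasure (path_measure K s) {\<omega>. \<omega> n \<in> T} = emeasure (IT.CI ?J) ?X"
    using IT.lim[OF _ X] unfolding emb_UNIV path_measure_def by simp
  also have "\<dots> = emeasure ?C ?X"
    using IT.emeasure_CI[OF _ X, of "Suc n"] unfolding emb_J by simp
  also have "\<dots> = (\<integral>\<^sup>+\<omega>. indicator ?X \<omega> \<partial>?C)"
    using X IT.sets_C[OF undef, of "Suc n"] by (simp del: IT.C.simps)
  also have "\<dots> = (\<integral>\<^sup>+\<omega>. indicator T (\<omega> n) \<partial>?C)"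
    using IT.space_C[OF undef, of "Suc n"]
    by (intro nn_integral_cong) (simp del: IT.C.simps split: split_indicator)
  also have "\<dots> = emeasure (chain_pmf K s n) T"
    by (subst nn_integral_chain_marginal) simp
  finally show ?thesis .
qed

text \<open>The event that coordinate 0 lies in \<open>UNIV\<close> is the whole space, so the total
  mass is that of \<open>chain_pmf K s 0\<close>.\<close>

lemma prob_space_path_measure: "prob_space (path_measure K s)"
  for K :: "'s::finite \<Rightarrow> 's pmf"
  using emeasure_path_coordinate[of K s 0 UNIV]
  by (intro prob_spaceI) (simp add: space_path_measure measure_pmf.emeasure_space_1[simplified])

lemma reach_prob_le_1: "reach_prob G \<rho> \<sigma> s \<le> 1"
  for G :: "('s::finite, 'a::finite, 'b::finite) csg"
  unfolding reach_prob_def by (rule prob_space.prob_le_1[OF prob_space_path_measure])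

text \<open>A play that is in the target at time \<open>n\<close> has visited it.\<close>

lemma chain_pmf_le_reach_prob:
  fixes G :: "('s::finite, 'a::finite, 'b::finite) csg"
  shows "measure (chain_pmf (step_pmf G \<rho> \<sigma>) s n) (target G) \<le> reach_prob G \<rho> \<sigma> s"
proof -
  interpret prob_space "path_measure (step_pmf G \<rho> \<sigma>) s"
    by (rule prob_space_path_measure)
  have "{\<omega>. \<exists>n. \<omega> n \<in> target G} \<in> sets (path_measure (step_pmf G \<rho> \<sigma>) s)"
    unfolding Collect_ex_eq by (intro sets.countable_UN) (auto simp: sets_path_coordinate)
  then show ?thesis
    unfolding reach_prob_def measure_def emeasure_path_coordinate[symmetric]
    by (fold measure_def, intro finite_measure_mono) auto
qed

subsection \<open>The one-step game\<close>

text \<open>\<open>step_pmf\<close> for local strategies at a single state. Its support is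
  \<open>Post\<close>, which links expectations to end components.\<close>

definition succ_pmf :: "('s, 'a, 'b) csg \<Rightarrow> 's \<Rightarrow> 'a pmf \<Rightarrow> 'b pmf \<Rightarrow> 's pmf" where
  "succ_pmf G s \<rho> \<sigma> = bind_pmf \<rho> (\<lambda>a. bind_pmf \<sigma> (\<lambda>b. trans_prob G s a b))"

lemma set_succ_pmf: "set_pmf (succ_pmf G s \<rho> \<sigma>) = Post G s \<rho> \<sigma>"
  by (simp add: succ_pmf_def Post_def set_bind_pmf)

lemma step_pmf_eq_succ: "step_pmf G \<rho> \<sigma> s = succ_pmf G s (\<rho> s) (\<sigma> s)"
  by (simp add: step_pmf_def succ_pmf_def)

lemma succ_pmf_absorbing:
  assumes "absorbing G s" "\<rho> \<in> local1 G s" "\<sigma> \<in> local2 G s"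
  shows "succ_pmf G s \<rho> \<sigma> = return_pmf s"
proof -
  have "succ_pmf G s \<rho> \<sigma> = bind_pmf \<rho> (\<lambda>a. bind_pmf \<sigma> (\<lambda>b. return_pmf s))"
    unfolding succ_pmf_def using assms
    by (intro bind_pmf_cong refl) (auto simp: absorbing_def local1_def local2_def)
  then show ?thesis by simp
qed

lemma pmf_bind_finite:
  "pmf (bind_pmf M f) y = (\<Sum>x\<in>UNIV. pmf M x * pmf (f x) y)" for M :: "'x::finite pmf"
  by (subst pmf_bind, subst integral_measure_pmf_real[of UNIV]) (simp_all add: mult.commute)

lemma measure_bind_pmf_finite:
  "measure (bind_pmf M f) T = (\<Sum>x\<in>UNIV. pmf M x * measure (f x) T)" for M :: "'x::finite pmf"
  by (subst measure_pmf_bind[of _ f], subst measure_pmf.measure_bind[where N="count_space UNIV"])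
    (auto simp: integral_measure_pmf_real[of UNIV] mult.commute measure_pmf_in_subprob_algebra)

text \<open>The triple sum is the expectation of \<open>v\<close> under the successor distribution;
  monotonicity and linearity in \<open>v\<close> are read off from this form.\<close>

lemma bellman_at_eq:
  "bellman_at G v s \<rho> \<sigma> = (\<Sum>s'\<in>UNIV. pmf (succ_pmf G s \<rho> \<sigma>) s' * v s')"
proof -
  have "(\<Sum>s'\<in>UNIV. pmf (succ_pmf G s \<rho> \<sigma>) s' * v s') =
    (\<Sum>s'\<in>UNIV. \<Sum>a\<in>UNIV. \<Sum>b\<in>UNIV. pmf \<rho> a * pmf \<sigma> b * pmf (trans_prob G s a b) s' * v s')"
    unfolding succ_pmf_def pmf_bind_finite sum_distrib_right sum_distrib_left
    by (simp add: mult.assoc)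
  also have "\<dots> = bellman_at G v s \<rho> \<sigma>"
    unfolding bellman_at_def
    by (subst sum.swap, rule sum.cong[OF refl], subst sum.swap, rule refl)
  finally show ?thesis by simp
qed

text \<open>The weights sum to 1, so an additive constant passes through the expectation. The slack
  \<open>c\<close> serves the passages to the limit.\<close>

lemma bellman_at_mono_add:
  assumes "\<And>s'. u s' \<le> v s' + c"
  shows "bellman_at G u s \<rho> \<sigma> \<le> bellman_at G v s \<rho> \<sigma> + c"
proof -
  let ?p = "pmf (succ_pmf G s \<rho> \<sigma>)"
  have "(\<Sum>s'\<in>UNIV. ?p s' * u s') \<le> (\<Sum>s'\<in>UNIV. ?p s' * (v s' + c))"
    by (intro sum_mono mult_left_mono assms) simp
  also have "\<dots> = (\<Sum>s'\<in>UNIV. ?p s' * v s') + (\<Sum>s'\<in>UNIV. ?p s') * c"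
    by (simp add: distrib_left sum.distrib sum_distrib_right)
  finally show ?thesis
    by (simp add: bellman_at_eq sum_pmf_eq_1)
qed

lemma bellman_at_zero: "bellman_at G (\<lambda>_. 0) s \<rho> \<sigma> = 0"
  by (simp add: bellman_at_def)

lemma bellman_at_ge:
  assumes "\<And>s'. c \<le> v s'"
  shows "c \<le> bellman_at G v s \<rho> \<sigma>"
  using bellman_at_mono_add[of "\<lambda>_. 0" v "- c" G s \<rho> \<sigma>] assms by (simp add: bellman_at_zero)

lemma bellman_at_scale: "bellman_at G (\<lambda>s'. c * v s') s \<rho> \<sigma> = c * bellman_at G v s \<rho> \<sigma>"
  by (simp add: bellman_at_eq sum_distrib_left mult.left_commute)

lemma bellman_at_diff:
  "bellman_at G (\<lambda>s'. u s' - v s') s \<rho> \<sigma> = bellman_at G u s \<rho> \<sigma> - bellman_at G v s \<rho> \<sigma>"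
  by (simp add: bellman_at_eq right_diff_distrib sum_subtractf)

lemma bellman_at_linear1:
  "bellman_at G v s \<rho> \<sigma> = (\<Sum>a\<in>UNIV. pmf \<rho> a * bellman_at G v s (return_pmf a) \<sigma>)"
proof -
  have "succ_pmf G s \<rho> \<sigma> = bind_pmf \<rho> (\<lambda>a. succ_pmf G s (return_pmf a) \<sigma>)"
    by (simp add: succ_pmf_def bind_return_pmf)
  then show ?thesis
    by (simp add: bellman_at_eq pmf_bind_finite sum_distrib_left sum_distrib_right mult.assoc)
      (rule sum.swap)
qed

lemma bellman_at_linear2:
  "bellman_at G v s \<rho> \<sigma> = (\<Sum>b\<in>UNIV. pmf \<sigma> b * bellman_at G v s \<rho> (return_pmf b))"
proof -
  have "succ_pmf G s \<rho> \<sigma> = bind_pmf \<sigma> (\<lambda>b. succ_pmf G s \<rho> (return_pmf b))"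
    by (simp add: succ_pmf_def bind_return_pmf bind_commute_pmf[of \<rho>])
  then show ?thesis
    by (simp add: bellman_at_eq pmf_bind_finite sum_distrib_left sum_distrib_right mult.assoc)
      (rule sum.swap)
qed

text \<open>An average of values that are at most \<open>m\<close> can reach \<open>m\<close> only
  if every value of positive weight equals \<open>m\<close>.\<close>

lemma bellman_at_stable_set:
  assumes le: "\<And>s'. d s' \<le> m" and ge: "m \<le> bellman_at G d s \<rho> \<sigma>" and s': "s' \<in> Post G s \<rho> \<sigma>"
  shows "d s' = m"
proof -
  let ?p = "pmf (succ_pmf G s \<rho> \<sigma>)"
  have nonneg: "0 \<le> ?p x * (m - d x)" for x
    using le[of x] by simp
  have "(\<Sum>x\<in>UNIV. ?p x * (m - d x)) = m - bellman_at G d s \<rho> \<sigma>"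
    by (simp add: bellman_at_eq right_diff_distrib sum_subtractf sum_pmf_eq_1
        flip: sum_distrib_right)
  then have "(\<Sum>x\<in>UNIV. ?p x * (m - d x)) = 0"
    using ge sum_nonneg[of UNIV "\<lambda>x. ?p x * (m - d x)"] nonneg by fastforce
  then have "?p s' * (m - d s') = 0"
    using nonneg by (simp add: sum_nonneg_eq_0_iff)
  moreover have "?p s' \<noteq> 0"
    using s' by (simp add: set_succ_pmf flip: set_pmf_iff)
  ultimately show ?thesis by simp
qed

section \<open>Worst-case payoff of a local strategy\<close>

definition guaranteed ::
  "('s::finite, 'a::finite, 'b::finite) csg \<Rightarrow> ('s \<Rightarrow> real) \<Rightarrow> 's \<Rightarrow> 'a pmf \<Rightarrow> real" where
  "guaranteed G v s \<rho> = (INF \<sigma>\<in>local2 G s. bellman_at G v s \<rho> \<sigma>)"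

lemma return_in_local2 [simp]: "return_pmf b \<in> local2 G s \<longleftrightarrow> b \<in> act2 G s"
  by (simp add: local2_def)

lemma return_in_local1 [simp]: "return_pmf a \<in> local1 G s \<longleftrightarrow> a \<in> act1 G s"
  by (simp add: local1_def)

lemma local_nonempty:
  assumes "is_csg G"
  shows "local1 G s \<noteq> {}" "local2 G s \<noteq> {}"
  using assms unfolding is_csg_def
  by (metis return_in_local1 ex_in_conv, metis return_in_local2 ex_in_conv)

lemma guaranteed_le:
  assumes "\<sigma> \<in> local2 G s"
  shows "guaranteed G v s \<rho> \<le> bellman_at G v s \<rho> \<sigma>"
proof -
  have "bdd_below (bellman_at G v s \<rho> ` local2 G s)"
    by (intro bdd_belowI2[of _ "Min (range v)"] bellman_at_ge) simp
  then show ?thesis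
    unfolding guaranteed_def using assms by (intro cINF_lower)
qed

lemma guaranteed_ge:
  assumes "is_csg G" and "\<And>\<sigma>. \<sigma> \<in> local2 G s \<Longrightarrow> c \<le> bellman_at G v s \<rho> \<sigma>"
  shows "c \<le> guaranteed G v s \<rho>"
  unfolding guaranteed_def using assms(2) local_nonempty(2)[OF assms(1)] by (intro cINF_greatest)

text \<open>The payoff is linear in Player 2's mixture, so no mixture does better for that player
  than the best pure action. The infimum becomes a finite minimum, which is attained and
  continuous.\<close>

lemma guaranteed_eq_Min:
  assumes "is_csg G"
  shows "guaranteed G v s \<rho> = (MIN b\<in>act2 G s. bellman_at G v s \<rho> (return_pmf b))"
    (is "_ = ?m")
proof (rule antisym)
  have ne: "act2 G s \<noteq> {}" using assms by (simp add: is_csg_def)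
  then show "guaranteed G v s \<rho> \<le> ?m"
    by (auto intro!: guaranteed_le)
  show "?m \<le> guaranteed G v s \<rho>"
  proof (rule guaranteed_ge[OF assms])
    fix \<sigma> assume \<sigma>: "\<sigma> \<in> local2 G s"
    have "?m = (\<Sum>b\<in>UNIV. pmf \<sigma> b * ?m)"
      by (simp add: sum_pmf_eq_1 flip: sum_distrib_right)
    also have "\<dots> \<le> (\<Sum>b\<in>UNIV. pmf \<sigma> b * bellman_at G v s \<rho> (return_pmf b))"
    proof (rule sum_mono)
      fix b
      show "pmf \<sigma> b * ?m \<le> pmf \<sigma> b * bellman_at G v s \<rho> (return_pmf b)"
      proof (cases "b \<in> act2 G s")
        case True
        then show ?thesis by (intro mult_left_mono Min_le) auto
      next
        case False
        then have "pmf \<sigma> b = 0"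
          using \<sigma> by (auto simp: local2_def pmf_eq_0_set_pmf)
        then show ?thesis by simp
      qed
    qed
    finally show "?m \<le> bellman_at G v s \<rho> \<sigma>"
      by (subst bellman_at_linear2)
  qed
qed

lemma guaranteed_attained:
  assumes "is_csg G"
  obtains \<sigma> where "\<sigma> \<in> local2 G s" "bellman_at G v s \<rho> \<sigma> = guaranteed G v s \<rho>"
proof -
  have "act2 G s \<noteq> {}" using assms by (simp add: is_csg_def)
  then have "(MIN b\<in>act2 G s. bellman_at G v s \<rho> (return_pmf b))
      \<in> (\<lambda>b. bellman_at G v s \<rho> (return_pmf b)) ` act2 G s"
    by (intro Min_in) auto
  then show ?thesis
    using that[of "return_pmf _"] guaranteed_eq_Min[OF assms, of v s \<rho>] by (auto simp: image_iff)
qed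

section \<open>Existence of optimal local strategies by compactness\<close>

lemma continuous_on_Min_finite:
  fixes f :: "'i \<Rightarrow> 'x::topological_space \<Rightarrow> real"
  assumes "finite B" "B \<noteq> {}" "\<And>b. b \<in> B \<Longrightarrow> continuous_on S (f b)"
  shows "continuous_on S (\<lambda>x. MIN b\<in>B. f b x)"
  using assms
  by (induction B rule: finite_ne_induct) (auto intro!: continuous_intros)

text \<open>A closed subset of the unit box. The set \<open>Z\<close> will hold the disabled
  actions.\<close>

lemma compact_restricted_simplex:
  "compact {p :: real ^ 'n. (\<forall>i. 0 \<le> p $ i) \<and> (\<Sum>i\<in>UNIV. p $ i) = 1 \<and> (\<forall>i\<in>Z. p $ i = 0)}"
    (is "compact ?S")
proof -
  have "?S = (\<Inter>i. {p. 0 \<le> p $ i}) \<inter> {p. (\<Sum>i\<in>UNIV. p $ i) = 1} \<inter> (\<Inter>i\<in>Z. {p. p $ i = 0})"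
    by auto
  also have "closed \<dots>"
    by (intro closed_Int closed_INT ballI closed_Collect_le closed_Collect_eq continuous_intros)
  finally have "closed ?S" .
  have "p $ i \<le> 1" if "\<forall>i. 0 \<le> p $ i" "(\<Sum>i\<in>UNIV. p $ i) = 1" for p :: "real ^ 'n" and i
    using member_le_sum[of i UNIV "($) p"] that by simp
  then have "?S \<subseteq> cbox 0 1"
    by (auto simp: mem_box_cart)
  then have "bounded ?S"
    by (rule bounded_subset[OF bounded_cbox])
  with \<open>closed ?S\<close> show ?thesis
    by (simp add: compact_eq_bounded_closed)
qed

text \<open>Local strategies become vectors in a compact face of the simplex, where the worst-case
  payoff is a minimum of finitely many linear functions. A continuous function attains its maximum
  there.\<close>

lemma guaranteed_maximum:
  fixes G :: "('s::finite, 'a::finite, 'b::finite) csg"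
  assumes "is_csg G"
  shows "\<exists>\<rho>\<in>local1 G s. \<forall>\<rho>'\<in>local1 G s. guaranteed G v s \<rho>' \<le> guaranteed G v s \<rho>"
proof -
  define S where "S = {p :: real ^ 'a. (\<forall>a. 0 \<le> p $ a) \<and> (\<Sum>a\<in>UNIV. p $ a) = 1 \<and> (\<forall>a\<in>- act1 G s. p $ a = 0)}"
  define f where "f p = (MIN b\<in>act2 G s. \<Sum>a\<in>UNIV. p $ a * bellman_at G v s (return_pmf a) (return_pmf b))"
    for p :: "real ^ 'a"
  have vec_in: "(\<chi> a. pmf \<rho> a) \<in> S" if "\<rho> \<in> local1 G s" for \<rho>
    using that by (auto simp: S_def sum_pmf_eq_1 local1_def pmf_eq_0_set_pmf)
  have f_vec: "f (\<chi> a. pmf \<rho> a) = guaranteed G v s \<rho>" for \<rho>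
    unfolding f_def guaranteed_eq_Min[OF assms] by (subst (2) bellman_at_linear1) simp
  have "compact S"
    unfolding S_def by (rule compact_restricted_simplex)
  moreover have "S \<noteq> {}"
    using vec_in local_nonempty(1)[OF assms] by blast
  moreover have "continuous_on S f"
    unfolding f_def using assms
    by (intro continuous_on_Min_finite continuous_intros) (auto simp: is_csg_def)
  ultimately obtain p where p: "p \<in> S" and max: "\<And>q. q \<in> S \<Longrightarrow> f q \<le> f p"
    using continuous_attains_sup by metis
  \<comment> \<open>The maximising vector is turned back into a distribution; membership in
    \<open>S\<close> gives nonnegativity and total mass 1.\<close>
  define \<rho> where "\<rho> = embed_pmf (($) p)"
  have pmf_\<rho>: "pmf \<rho> a = p $ a" for a
    unfolding \<rho>_def
  proof (rule pmf_embed_pmf)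
    show "(\<integral>\<^sup>+a. ennreal (p $ a) \<partial>count_space UNIV) = 1"
      using p by (simp add: S_def nn_integral_count_space_finite sum_ennreal)
  qed (use p in \<open>simp add: S_def\<close>)
  have p_eq: "p = (\<chi> a. pmf \<rho> a)"
    by (simp add: pmf_\<rho> vec_eq_iff)
  show ?thesis
  proof (intro bexI ballI)
    show "\<rho> \<in> local1 G s"
      using p by (auto simp: local1_def set_pmf_iff pmf_\<rho> S_def)
    show "guaranteed G v s \<rho>' \<le> guaranteed G v s \<rho>" if "\<rho>' \<in> local1 G s" for \<rho>'
      using max[OF vec_in[OF that]] p_eq by (simp add: f_vec)
  qed
qed

lemma bellman_attained:
  assumes "is_csg G"
  obtains \<rho> where "\<rho> \<in> local1 G s" "guaranteed G v s \<rho> = bellman G v s"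
proof -
  obtain \<rho> where \<rho>: "\<rho> \<in> local1 G s"
      "\<forall>\<rho>'\<in>local1 G s. guaranteed G v s \<rho>' \<le> guaranteed G v s \<rho>"
    using guaranteed_maximum[OF assms] by blast
  then have "bellman G v s = guaranteed G v s \<rho>"
    unfolding bellman_def guaranteed_def[symmetric] by (intro cSup_eq_maximum) auto
  with \<rho> that show ?thesis by simp
qed

lemma guaranteed_le_bellman:
  assumes "is_csg G" "\<rho> \<in> local1 G s"
  shows "guaranteed G v s \<rho> \<le> bellman G v s"
proof -
  have "bdd_above (guaranteed G v s ` local1 G s)"
    using guaranteed_maximum[OF assms(1), of s v] by (auto intro: bdd_aboveI2)
  then show ?thesis
    unfolding bellman_def guaranteed_def[symmetric] using assms(2) by (intro cSUP_upper)
qed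

text \<open>An optimal strategy with the largest number of actions works: averaging it with any
  other optimal one is again optimal and has the union of the supports, so that union cannot be
  larger.\<close>

lemma bellman_attained_max_support:
  fixes G :: "('s::finite, 'a::finite, 'b::finite) csg"
  assumes "is_csg G"
  obtains \<rho> where "\<rho> \<in> local1 G s" "guaranteed G v s \<rho> = bellman G v s"
    "\<And>\<rho>'. \<rho>' \<in> local1 G s \<Longrightarrow> guaranteed G v s \<rho>' = bellman G v s \<Longrightarrow> set_pmf \<rho>' \<subseteq> set_pmf \<rho>"
proof -
  define Opt where "Opt = {\<rho> \<in> local1 G s. guaranteed G v s \<rho> = bellman G v s}"
  have "\<exists>\<rho>. \<rho> \<in> Opt"
    using bellman_attained[OF assms] unfolding Opt_def by blast
  moreover have "\<forall>\<rho>. \<rho> \<in> Opt \<longrightarrow> card (set_pmf \<rho>) < Suc (card (UNIV :: 'a set))"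
    by (simp add: less_Suc_eq_le card_mono)
  ultimately obtain \<rho> where \<rho>: "\<rho> \<in> Opt" and max: "\<And>\<rho>'. \<rho>' \<in> Opt \<Longrightarrow> card (set_pmf \<rho>') \<le> card (set_pmf \<rho>)"
    using ex_has_greatest_nat[of "\<lambda>\<rho>. \<rho> \<in> Opt" _ "\<lambda>\<rho>. card (set_pmf \<rho>)"] by metis
  have "set_pmf \<rho>' \<subseteq> set_pmf \<rho>" if \<rho>': "\<rho>' \<in> Opt" for \<rho>'
  proof -
    \<comment> \<open>A fair coin chooses between the two strategies; both outcomes have positive
      weight, so both supports survive.\<close>
    define \<mu> where "\<mu> = bind_pmf (bernoulli_pmf (1/2)) (\<lambda>x. if x then \<rho> else \<rho>')"
    have set_\<mu>: "set_pmf \<mu> = set_pmf \<rho> \<union> set_pmf \<rho>'"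
      by (auto simp: \<mu>_def set_bind_pmf set_pmf_bernoulli UNIV_bool)
    have \<mu>_local: "\<mu> \<in> local1 G s"
      using \<rho> \<rho>' by (simp add: Opt_def local1_def set_\<mu>)
    have pmf_\<mu>: "pmf \<mu> a = (pmf \<rho> a + pmf \<rho>' a) / 2" for a
      by (simp add: \<mu>_def pmf_bind field_simps)
    have bellman_\<mu>: "bellman_at G v s \<mu> \<sigma> = (bellman_at G v s \<rho> \<sigma> + bellman_at G v s \<rho>' \<sigma>) / 2" for \<sigma>
      by (subst (1 2 3) bellman_at_linear1)
        (simp add: pmf_\<mu> sum_divide_distrib add_divide_distrib distrib_right sum.distrib)
    have "bellman G v s \<le> guaranteed G v s \<mu>"
    proof (rule guaranteed_ge[OF assms])
      fix \<sigma> assume "\<sigma> \<in> local2 G s"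
      then show "bellman G v s \<le> bellman_at G v s \<mu> \<sigma>"
        using \<rho> \<rho>' guaranteed_le[of \<sigma> G s v \<rho>] guaranteed_le[of \<sigma> G s v \<rho>']
        by (simp add: Opt_def bellman_\<mu>)
    qed
    then have "\<mu> \<in> Opt"
      using guaranteed_le_bellman[OF assms \<mu>_local] \<mu>_local by (auto simp: Opt_def intro: antisym)
    then have "card (set_pmf \<rho> \<union> set_pmf \<rho>') \<le> card (set_pmf \<rho>)"
      using max[of \<mu>] by (simp add: set_\<mu>)
    then have "set_pmf \<rho> = set_pmf \<rho> \<union> set_pmf \<rho>'"
      by (intro card_seteq) auto
    then show ?thesis by blast
  qed
  with \<rho> that show thesis
    unfolding Opt_def by blast
qed

section \<open>Order properties of the Bellman operator\<close>

lemma bellman_mono_add: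
  assumes G: "is_csg G" and le: "\<And>s'. u s' \<le> v s' + c"
  shows "bellman G u s \<le> bellman G v s + c"
proof -
  obtain \<rho> where \<rho>: "\<rho> \<in> local1 G s" "guaranteed G u s \<rho> = bellman G u s"
    by (rule bellman_attained[OF G])
  \<comment> \<open>Player 1 plays optimally for \<open>u\<close>, Player 2 replies optimally for
    \<open>v\<close>; at this one pair the two payoffs can be compared.\<close>
  obtain \<sigma> where \<sigma>: "\<sigma> \<in> local2 G s" "bellman_at G v s \<rho> \<sigma> = guaranteed G v s \<rho>"
    by (rule guaranteed_attained[OF G])
  have "bellman G u s \<le> bellman_at G u s \<rho> \<sigma>"
    using guaranteed_le[OF \<sigma>(1), of u \<rho>] \<rho>(2) by simp
  also have "\<dots> \<le> bellman_at G v s \<rho> \<sigma> + c"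
    by (rule bellman_at_mono_add[OF le])
  also have "\<dots> \<le> bellman G v s + c"
    using guaranteed_le_bellman[OF G \<rho>(1), of v] \<sigma>(2) by simp
  finally show ?thesis .
qed

lemma bellman_mono:
  assumes "is_csg G" and "\<And>s'. u s' \<le> v s'"
  shows "bellman G u s \<le> bellman G v s"
  using bellman_mono_add[of G u v 0 s] assms by simp

lemma bellman_zero: "is_csg G \<Longrightarrow> bellman G (\<lambda>_. 0) s = 0"
  unfolding bellman_def bellman_at_zero by (simp add: local_nonempty)

lemma bellman_le:
  assumes "is_csg G" and "\<And>s'. v s' \<le> c"
  shows "bellman G v s \<le> c"
  using bellman_mono_add[of G v "\<lambda>_. 0" c s] assms by (simp add: bellman_zero)

lemma bellman_nonneg:
  assumes "is_csg G" and "\<And>s'. 0 \<le> v s'"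
  shows "0 \<le> bellman G v s"
  using bellman_mono[of G "\<lambda>_. 0" v s] assms by (simp add: bellman_zero)

lemma bellman_scale_ge:
  assumes G: "is_csg G" and c: "0 \<le> c"
  shows "c * bellman G v s \<le> bellman G (\<lambda>s'. c * v s') s"
proof -
  obtain \<rho> where \<rho>: "\<rho> \<in> local1 G s" "guaranteed G v s \<rho> = bellman G v s"
    by (rule bellman_attained[OF G])
  have "c * bellman G v s \<le> guaranteed G (\<lambda>s'. c * v s') s \<rho>"
    using c \<rho>(2) guaranteed_le[of _ G s v \<rho>]
    by (intro guaranteed_ge[OF G]) (simp add: bellman_at_scale mult_left_mono)
  also have "\<dots> \<le> bellman G (\<lambda>s'. c * v s') s"
    by (rule guaranteed_le_bellman[OF G \<rho>(1)])
  finally show ?thesis .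
qed

lemma bellman_absorbing:
  assumes G: "is_csg G" and s: "absorbing G s"
  shows "bellman G v s = v s"
proof -
  obtain \<rho> where \<rho>: "\<rho> \<in> local1 G s" "guaranteed G v s \<rho> = bellman G v s"
    by (rule bellman_attained[OF G])
  obtain \<sigma> where \<sigma>: "\<sigma> \<in> local2 G s" "bellman_at G v s \<rho> \<sigma> = guaranteed G v s \<rho>"
    by (rule guaranteed_attained[OF G])
  have "bellman_at G v s \<rho> \<sigma> = v s"
    unfolding bellman_at_eq succ_pmf_absorbing[OF s \<rho>(1) \<sigma>(1)]
    by (simp add: indicator_def)
  with \<rho> \<sigma> show ?thesis by simp
qed

lemma max_support_optimal_strategy:
  fixes G :: "('s::finite, 'a::finite, 'b::finite) csg"
  assumes G: "is_csg G"
  obtains \<rho> where "\<And>s. \<rho> s \<in> local1 G s" "\<And>s. guaranteed G v s (\<rho> s) = bellman G v s"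
    "\<And>s \<rho>'. \<rho>' \<in> local1 G s \<Longrightarrow> guaranteed G v s \<rho>' = bellman G v s
      \<Longrightarrow> set_pmf \<rho>' \<subseteq> set_pmf (\<rho> s)"
proof -
  define max_opt where "max_opt s r \<longleftrightarrow> r \<in> local1 G s \<and> guaranteed G v s r = bellman G v s \<and>
      (\<forall>\<rho>'\<in>local1 G s. guaranteed G v s \<rho>' = bellman G v s \<longrightarrow> set_pmf \<rho>' \<subseteq> set_pmf r)" for s r
  have "\<forall>s. \<exists>r. max_opt s r"
  proof
    fix s
    show "\<exists>r. max_opt s r"
      unfolding max_opt_def by (rule bellman_attained_max_support[OF G, of s v]) blast
  qed
  from choice[OF this] obtain \<rho> where "\<forall>s. max_opt s (\<rho> s)"
    by (rule exE)
  then show thesis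
    by (intro that[of \<rho>]) (simp_all add: max_opt_def)
qed

subsection \<open>Value iteration from above\<close>

lemma upper_iter_nonneg: "is_csg G \<Longrightarrow> 0 \<le> upper_iter G k s"
  by (induction k arbitrary: s) (simp_all add: bellman_nonneg)

lemma upper_iter_le_1: "is_csg G \<Longrightarrow> upper_iter G k s \<le> 1"
  by (induction k arbitrary: s) (simp_all add: bellman_le)

lemma upper_iter_absorbing_zero:
  assumes "is_csg G" "s \<in> zero_states G" "absorbing G s"
  shows "upper_iter G k s = 0"
  by (induction k) (simp_all add: assms bellman_absorbing)

text \<open>The first step goes down because value-zero states are absorbing and keep the value 0,
  while 1 is the largest value elsewhere. Monotonicity of the operator carries this to all later
  steps.\<close>

lemma decseq_upper_iter:
  assumes G: "is_csg G" and zero: "\<And>s. s \<in> zero_states G \<Longrightarrow> absorbing G s"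
  shows "decseq (\<lambda>k. upper_iter G k s)"
proof -
  have "upper_iter G (Suc k) s \<le> upper_iter G k s" for k s
  proof (induction k arbitrary: s)
    case 0
    show ?case
    proof (cases "s \<in> zero_states G")
      case True
      then show ?thesis
        using upper_iter_absorbing_zero[OF G True zero, of "Suc 0"] by simp
    next
      case False
      then show ?thesis
        using upper_iter_le_1[OF G, of "Suc 0" s] by simp
    qed
  next
    case (Suc k)
    then show ?case
      by (simp add: bellman_mono[OF G])
  qed
  then show ?thesis
    by (simp add: decseq_Suc_iff)
qed

lemma upper_iter_tendsto:
  assumes "is_csg G" and "\<And>s. s \<in> zero_states G \<Longrightarrow> absorbing G s"
  shows "(\<lambda>k. upper_iter G k s) \<longlonglongrightarrow> upper_limit G s"
proof -
  have dec: "decseq (\<lambda>k. upper_iter G k s)"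
    using assms by (rule decseq_upper_iter)
  have "convergent (\<lambda>k. upper_iter G k s)"
    by (rule decseq_convergent[OF dec, of 0]) (simp_all add: upper_iter_nonneg[OF assms(1)] convergentI)
  then show ?thesis
    by (simp add: upper_limit_def convergent_LIMSEQ_iff)
qed

lemma upper_limit_le_1:
  assumes "is_csg G" and "\<And>s. s \<in> zero_states G \<Longrightarrow> absorbing G s"
  shows "upper_limit G s \<le> 1"
  by (rule LIMSEQ_le_const2[OF upper_iter_tendsto[OF assms]]) (auto simp: upper_iter_le_1[OF assms(1)])

lemma upper_limit_zero:
  assumes "is_csg G" and "\<And>s. s \<in> zero_states G \<Longrightarrow> absorbing G s" and "s \<in> zero_states G"
  shows "upper_limit G s = 0"
  unfolding upper_limit_def
  by (simp add: upper_iter_absorbing_zero[OF assms(1,3) assms(2)[OF assms(3)]])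

text \<open>There are finitely many states, so some iterate exceeds the limit by at most
  \<open>e\<close> everywhere. One more application of the operator still lies above the limit and
  is at most \<open>e\<close> above its image.\<close>

lemma upper_limit_le_bellman:
  assumes G: "is_csg G" and zero: "\<And>s. s \<in> zero_states G \<Longrightarrow> absorbing G s"
  shows "upper_limit G s \<le> bellman G (upper_limit G) s"
proof (rule field_le_epsilon)
  fix e :: real assume e: "0 < e"
  have lim: "(\<lambda>k. upper_iter G k s) \<longlonglongrightarrow> upper_limit G s" for s
    using G zero by (rule upper_iter_tendsto)
  have "\<forall>\<^sub>F k in sequentially. \<forall>s'\<in>UNIV. upper_iter G k s' < upper_limit G s' + e"
    using e by (intro eventually_ball_finite ballI order_tendstoD(2)[OF lim]) simp_all
  then obtain k where k: "\<And>s'. upper_iter G k s' \<le> upper_limit G s' + e"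
    by (auto simp: eventually_sequentially intro: less_imp_le)
  have "upper_limit G s \<le> upper_iter G (Suc k) s"
    by (rule decseq_ge[OF decseq_upper_iter[OF G zero] lim])
  also have "\<dots> \<le> bellman G (upper_limit G) s + e"
    by (simp add: bellman_mono_add[OF G k])
  finally show "upper_limit G s \<le> bellman G (upper_limit G) s + e" .
qed

subsection \<open>Value iteration from below\<close>

text \<open>
  For \<open>c = 1\<close> this is ordinary value iteration from below. Discounting (\<open>c < 1\<close>) is needed because a
  memoryless strategy that is optimal for an undiscounted iterate may postpone reaching the target forever.
\<close>

primrec disc_iter :: "('s::finite, 'a::finite, 'b::finite) csg \<Rightarrow> real \<Rightarrow> nat \<Rightarrow> 's \<Rightarrow> real" where
  "disc_iter G c 0 = indicator (target G)"
| "disc_iter G c (Suc k) = (\<lambda>s. if s \<in> target G then 1 else c * bellman G (disc_iter G c k) s)"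

lemma disc_iter_target: "s \<in> target G \<Longrightarrow> disc_iter G c k s = 1"
  by (cases k) simp_all

lemma disc_iter_nonneg: "is_csg G \<Longrightarrow> 0 \<le> c \<Longrightarrow> 0 \<le> disc_iter G c k s"
  by (induction k arbitrary: s) (simp_all add: bellman_nonneg)

lemma disc_iter_le_1: "is_csg G \<Longrightarrow> 0 \<le> c \<Longrightarrow> c \<le> 1 \<Longrightarrow> disc_iter G c k s \<le> 1"
proof (induction k arbitrary: s)
  case (Suc k)
  then have "0 \<le> bellman G (disc_iter G c k) s" "bellman G (disc_iter G c k) s \<le> 1"
    by (auto intro!: bellman_nonneg bellman_le disc_iter_nonneg)
  with Suc.prems show ?case
    by (simp add: mult_le_one)
qed (simp add: indicator_def)

lemma disc_iter_le_Suc: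
  assumes "is_csg G" "0 \<le> c"
  shows "disc_iter G c k s \<le> disc_iter G c (Suc k) s"
proof (induction k arbitrary: s)
  case 0
  show ?case
    using assms by (simp add: bellman_nonneg indicator_def)
next
  case (Suc k)
  then show ?case
    using assms by (simp add: mult_left_mono bellman_mono)
qed

text \<open>Each of the \<open>k\<close> rounds loses at most one factor \<open>c\<close>, which the
  operator lets through by \<open>bellman_scale_ge\<close>; on the target both iterations have value
  1.\<close>

lemma disc_iter_ge_power:
  assumes G: "is_csg G" and c: "0 \<le> c" "c \<le> 1"
  shows "c ^ k * disc_iter G 1 k s \<le> disc_iter G c k s"
proof (induction k arbitrary: s)
  case (Suc k)
  show ?case
  proof (cases "s \<in> target G")
    case True
    then show ?thesis using c by (simp add: mult_le_one power_le_one)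
  next
    case False
    have "c ^ k * bellman G (disc_iter G 1 k) s \<le> bellman G (\<lambda>s. c ^ k * disc_iter G 1 k s) s"
      using c by (intro bellman_scale_ge[OF G]) simp
    also have "\<dots> \<le> bellman G (disc_iter G c k) s"
      by (rule bellman_mono[OF G Suc.IH])
    finally show ?thesis
      using False c by (simp add: mult.assoc mult_left_mono)
  qed
qed simp

lemma chain_pmf_absorbing: "K s = return_pmf s \<Longrightarrow> chain_pmf K s n = return_pmf s"
  by (induction n) (simp_all add: bind_return_pmf)

text \<open>
  After \<open>n\<close> steps, the part of \<open>v\<close> not yet accounted for by visits to the target is at most \<open>c ^ n\<close>.
\<close>

lemma sub_discounted_le_reach_prob:
  fixes G :: "('s::finite, 'a::finite, 'b::finite) csg"
  assumes T: "\<And>s. s \<in> target G \<Longrightarrow> absorbing G s"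
    and \<rho>: "\<rho> \<in> strategies1 G" and \<sigma>: "\<sigma> \<in> strategies2 G"
    and c: "0 \<le> c" "c < 1" and v1: "\<And>s. v s \<le> 1"
    and sub: "\<And>s. s \<notin> target G \<Longrightarrow> v s \<le> c * bellman_at G v s (\<rho> s) (\<sigma> s)"
  shows "v s \<le> reach_prob G \<rho> \<sigma> s"
proof -
  let ?K = "step_pmf G \<rho> \<sigma>"
  let ?h = "\<lambda>n s. measure (chain_pmf ?K s n) (target G)"
  have bound: "v s \<le> ?h n s + c ^ n" for n s
  proof (induction n arbitrary: s)
    case 0
    show ?case
      using v1[of s] by (simp add: add_increasing)
  next
    case (Suc n)
    show ?case
    proof (cases "s \<in> target G")
      case True
      then have "?K s = return_pmf s"
        using \<rho> \<sigma> T
        by (simp add: step_pmf_eq_succ succ_pmf_absorbing strategies1_def strategies2_def)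
      then have "chain_pmf ?K s (Suc n) = return_pmf s"
        by (rule chain_pmf_absorbing)
      then show ?thesis
        using True v1[of s] c(1) by (simp del: chain_pmf.simps add: add_increasing2)
    next
      case False
      \<comment> \<open>Conditioning on the first step.\<close>
      have h_Suc: "?h (Suc n) s = bellman_at G (?h n) s (\<rho> s) (\<sigma> s)"
        unfolding chain_pmf_Suc_left
        by (simp add: bellman_at_eq measure_bind_pmf_finite step_pmf_eq_succ)
      have nonneg: "0 \<le> bellman_at G (?h n) s (\<rho> s) (\<sigma> s)"
        by (rule bellman_at_ge) simp
      have "v s \<le> c * bellman_at G v s (\<rho> s) (\<sigma> s)"
        by (rule sub[OF False])
      also have "\<dots> \<le> c * (bellman_at G (?h n) s (\<rho> s) (\<sigma> s) + c ^ n)"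
        by (intro mult_left_mono bellman_at_mono_add Suc.IH c)
      also have "\<dots> \<le> bellman_at G (?h n) s (\<rho> s) (\<sigma> s) + c ^ Suc n"
        using mult_right_mono[of c 1, OF _ nonneg] c by (simp add: distrib_left)
      finally show ?thesis
        unfolding h_Suc .
    qed
  qed
  have "v s \<le> reach_prob G \<rho> \<sigma> s + c ^ n" for n
    using bound[of s n] chain_pmf_le_reach_prob[of G \<rho> \<sigma> s n] by linarith
  moreover have "(\<lambda>n. reach_prob G \<rho> \<sigma> s + c ^ n) \<longlonglongrightarrow> reach_prob G \<rho> \<sigma> s + 0"
    using c by (intro tendsto_intros LIMSEQ_power_zero) simp
  ultimately show ?thesis
    by (auto intro: LIMSEQ_le_const)
qed

text \<open>One memoryless strategy of Player 1 certifies a lower bound on the value. Reachability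
  probabilities lie between 0 and 1, so the supremum and infimum are well behaved.\<close>

lemma le_valI:
  fixes G :: "('s::finite, 'a::finite, 'b::finite) csg"
  assumes G: "is_csg G" and \<rho>: "\<rho> \<in> strategies1 G"
    and le: "\<And>\<sigma>. \<sigma> \<in> strategies2 G \<Longrightarrow> x \<le> reach_prob G \<rho> \<sigma> s"
  shows "x \<le> val G s"
proof -
  have "\<forall>s. \<exists>\<sigma>. \<sigma> \<in> local2 G s"
    using local_nonempty(2)[OF G] by blast
  then obtain \<sigma> where \<sigma>: "\<sigma> \<in> strategies2 G"
    unfolding strategies2_def by (auto dest: choice)
  have "x \<le> (INF \<sigma>\<in>strategies2 G. reach_prob G \<rho> \<sigma> s)"
    using \<sigma> le by (intro cINF_greatest) auto
  also have "\<dots> \<le> val G s"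
    unfolding val_def
  proof (rule cSUP_upper[OF \<rho> bdd_aboveI2])
    fix \<rho>'
    have "(INF \<sigma>\<in>strategies2 G. reach_prob G \<rho>' \<sigma> s) \<le> reach_prob G \<rho>' \<sigma> s"
      by (rule cINF_lower[OF bdd_belowI2[of _ 0] \<sigma>]) (simp add: reach_prob_def)
    also have "\<dots> \<le> 1"
      by (rule reach_prob_le_1)
    finally show "(INF \<sigma>\<in>strategies2 G. reach_prob G \<rho>' \<sigma> s) \<le> 1" .
  qed
  finally show ?thesis .
qed

text \<open>The iterates increase, so \<open>v = disc_iter G c k\<close> is at most \<open>c\<close>
  times its Bellman image off the target. A strategy optimal for \<open>v\<close> inherits this
  bound against every \<sigma> and so reaches the target with probability at least
  \<open>v\<close>.\<close>

lemma disc_iter_le_val: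
  assumes G: "is_csg G" and T: "\<And>s. s \<in> target G \<Longrightarrow> absorbing G s" and c: "0 \<le> c" "c < 1"
  shows "disc_iter G c k s \<le> val G s"
proof -
  let ?v = "disc_iter G c k"
  obtain \<rho> where \<rho>: "\<And>s. \<rho> s \<in> local1 G s" "\<And>s. guaranteed G ?v s (\<rho> s) = bellman G ?v s"
    by (rule max_support_optimal_strategy[OF G, of ?v]) blast
  show ?thesis
  proof (rule le_valI[OF G])
    show \<rho>_strat: "\<rho> \<in> strategies1 G"
      using \<rho>(1) by (simp add: strategies1_def)
    show "?v s \<le> reach_prob G \<rho> \<sigma> s" if \<sigma>: "\<sigma> \<in> strategies2 G" for \<sigma>
    proof (rule sub_discounted_le_reach_prob[OF T \<rho>_strat \<sigma> c])
      show "?v s \<le> 1" for s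
        using G c by (simp add: disc_iter_le_1)
      show "?v s \<le> c * bellman_at G ?v s (\<rho> s) (\<sigma> s)" if "s \<notin> target G" for s
      proof -
        have "?v s \<le> c * bellman G ?v s"
          using disc_iter_le_Suc[OF G c(1), of k s] that by simp
        also have "\<dots> \<le> c * bellman_at G ?v s (\<rho> s) (\<sigma> s)"
          using \<sigma> guaranteed_le[of "\<sigma> s" G s ?v "\<rho> s"] \<rho>(2) c(1)
          by (intro mult_left_mono) (simp_all add: strategies2_def)
        finally show ?thesis .
      qed
    qed
  qed
qed

text \<open>For fixed \<open>k\<close>, the discount factor tends to 1 along
  \<open>1 - 1/(n+1)\<close> and the factor \<open>c ^ k\<close> disappears in the limit.\<close>

lemma lower_iter_le_val:
  assumes G: "is_csg G" and T: "\<And>s. s \<in> target G \<Longrightarrow> absorbing G s"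
  shows "disc_iter G 1 k s \<le> val G s"
proof -
  let ?c = "\<lambda>n. 1 - inverse (real (Suc n))"
  have "(\<lambda>n. ?c n ^ k * disc_iter G 1 k s) \<longlonglongrightarrow> (1 - 0) ^ k * disc_iter G 1 k s"
    by (intro tendsto_intros LIMSEQ_inverse_real_of_nat)
  moreover have "?c n ^ k * disc_iter G 1 k s \<le> val G s" for n
  proof -
    have c: "0 \<le> ?c n" "?c n < 1"
      by (simp_all add: field_simps)
    then show ?thesis
      using disc_iter_ge_power[OF G c(1), of k s] disc_iter_le_val[OF G T c, of k s] by linarith
  qed
  ultimately show ?thesis
    by (auto intro: LIMSEQ_le_const2)
qed

text \<open>\<open>L\<close> is the limit of undiscounted iteration from below. The super-fixpoint
  inequality mirrors \<open>upper_limit_le_bellman\<close>: by finiteness some iterate is within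
  \<open>e\<close> of \<open>L\<close> everywhere, and its successor is still at most
  \<open>L\<close>.\<close>

lemma ex_super_fixpoint_le_val:
  fixes G :: "('s::finite, 'a::finite, 'b::finite) csg"
  assumes G: "is_csg G" and T: "\<And>s. s \<in> target G \<Longrightarrow> absorbing G s"
  obtains L where "\<And>s. 0 \<le> L s" "\<And>s. L s \<le> val G s" "\<And>s. s \<in> target G \<Longrightarrow> L s = 1"
    "\<And>s. s \<notin> target G \<Longrightarrow> bellman G L s \<le> L s"
proof -
  let ?L = "\<lambda>k s. disc_iter G 1 k s"
  have inc: "incseq (\<lambda>k. ?L k s)" for s
    using disc_iter_le_Suc[OF G, of 1] by (auto simp: incseq_Suc_iff simp del: disc_iter.simps)
  define L where "L s = lim (\<lambda>k. ?L k s)" for s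
  have L: "(\<lambda>k. ?L k s) \<longlonglongrightarrow> L s" for s
  proof -
    have "\<forall>k. ?L k s \<le> 1"
      by (simp add: disc_iter_le_1[OF G])
    then have "convergent (\<lambda>k. ?L k s)"
      by (rule incseq_convergent[OF inc]) (rule convergentI)
    then show ?thesis
      by (simp add: L_def convergent_LIMSEQ_iff)
  qed
  show thesis
  proof
    show "0 \<le> L s" for s
      using disc_iter_nonneg[OF G, of 1] by (intro LIMSEQ_le_const[OF L]) auto
    show "L s \<le> val G s" for s
      using lower_iter_le_val[OF G T] by (intro LIMSEQ_le_const2[OF L]) auto
    show "L s = 1" if "s \<in> target G" for s
      using L[of s] that by (simp add: disc_iter_target LIMSEQ_const_iff)
    show "bellman G L s \<le> L s" if s: "s \<notin> target G" for s
    proof (rule field_le_epsilon)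
      fix e :: real assume e: "0 < e"
      have "\<forall>\<^sub>F k in sequentially. \<forall>s'\<in>UNIV. L s' - e < ?L k s'"
        using e by (intro eventually_ball_finite ballI order_tendstoD(1)[OF L]) simp_all
      then obtain k where "\<And>s'. L s' - e < ?L k s'"
        by (auto simp: eventually_sequentially)
      then have "bellman G L s \<le> bellman G (?L k) s + e"
        by (intro bellman_mono_add[OF G]) (simp add: less_imp_le algebra_simps)
      also have "bellman G (?L k) s = ?L (Suc k) s"
        using s by simp
      also have "\<dots> \<le> L s"
        by (rule incseq_le[OF inc L])
      finally show "bellman G L s \<le> L s + e" by simp
    qed
  qed
qed

subsection \<open>Bloated end components\<close>

text \<open>A nonempty subset closed under \<open>f\<close> of least cardinality is strongly
  connected, since the states reachable from any of its members again form such a subset.\<close>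

lemma ex_bottom_component:
  fixes f :: "'s::finite \<Rightarrow> 's set"
  assumes "Y \<noteq> {}" "\<And>s. s \<in> Y \<Longrightarrow> f s \<subseteq> Y"
  obtains X where "X \<subseteq> Y" "X \<noteq> {}" "\<And>s. s \<in> X \<Longrightarrow> f s \<subseteq> X"
    "\<And>s t. s \<in> X \<Longrightarrow> t \<in> X \<Longrightarrow> (s, t) \<in> {(u, u'). u \<in> X \<and> u' \<in> X \<and> u' \<in> f u}\<^sup>*"
proof -
  define closed_in where "closed_in X \<longleftrightarrow> X \<subseteq> Y \<and> X \<noteq> {} \<and> (\<forall>s\<in>X. f s \<subseteq> X)" for X
  have "closed_in Y"
    using assms by (auto simp: closed_in_def)
  then obtain X where X: "closed_in X" and min: "\<And>Z. closed_in Z \<Longrightarrow> card X \<le> card Z"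
    using ex_has_least_nat[of closed_in Y card] by blast
  show thesis
  proof
    show "X \<subseteq> Y" "X \<noteq> {}" "\<And>s. s \<in> X \<Longrightarrow> f s \<subseteq> X"
      using X by (auto simp: closed_in_def)
    fix s t assume s: "s \<in> X" and t: "t \<in> X"
    let ?R = "{(u, u'). u \<in> X \<and> u' \<in> X \<and> u' \<in> f u}"
    \<comment> \<open>By minimality of \<open>X\<close>, closedness of the reachable set forces it
      to be all of \<open>X\<close>.\<close>
    have "closed_in (?R\<^sup>* `` {s})"
      unfolding closed_in_def
    proof (intro conjI ballI subsetI)
      have sub: "?R\<^sup>* `` {s} \<subseteq> X"
        using s by (auto elim: rtranclE)
      then show "x \<in> Y" if "x \<in> ?R\<^sup>* `` {s}" for x
        using that X by (auto simp: closed_in_def)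
      show "?R\<^sup>* `` {s} \<noteq> {}" by blast
      show "y \<in> ?R\<^sup>* `` {s}" if "x \<in> ?R\<^sup>* `` {s}" "y \<in> f x" for x y
      proof -
        have "x \<in> X" using sub that by blast
        then have "(x, y) \<in> ?R" using X that by (auto simp: closed_in_def)
        with that(1) show ?thesis by (auto intro: rtrancl_into_rtrancl)
      qed
    qed
    moreover have "?R\<^sup>* `` {s} \<subseteq> X"
      using s by (auto elim: rtranclE)
    ultimately have "?R\<^sup>* `` {s} = X"
      by (intro card_seteq min) auto
    with t show "(s, t) \<in> ?R\<^sup>*" by blast
  qed
qed

lemma Post_mono: "set_pmf \<rho>' \<subseteq> set_pmf \<rho> \<Longrightarrow> Post G s \<rho>' \<sigma> \<subseteq> Post G s \<rho> \<sigma>"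
  by (auto simp: Post_def)

theorem theorem21:
  fixes G :: "('s::finite, 'a::finite, 'b::finite) csg"
  assumes "is_csg G"
    and "normal_form G"
    and "\<exists>s. upper_limit G s > val G s"
  shows "\<exists>X. X \<subseteq> - (target G \<union> zero_states G) \<and> bloated_end_component G (upper_limit G) X"
proof -
  let ?U = "upper_limit G"
  note G = assms(1)
  have T: "\<And>s. s \<in> target G \<Longrightarrow> absorbing G s" and W: "\<And>s. s \<in> zero_states G \<Longrightarrow> absorbing G s"
    using assms(2) by (auto simp: normal_form_def)
  obtain L where L0: "\<And>s. 0 \<le> L s" and L_val: "\<And>s. L s \<le> val G s"
    and L_target: "\<And>s. s \<in> target G \<Longrightarrow> L s = 1"
    and L_super: "\<And>s. s \<notin> target G \<Longrightarrow> bellman G L s \<le> L s"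
    using ex_super_fixpoint_le_val[OF G T] by blast
  define d where "d s = ?U s - L s" for s
  define m where "m = Max (range d)"
  have d_le: "d s \<le> m" for s
    by (simp add: m_def)
  have "0 < m"
  proof -
    obtain s where "val G s < ?U s" using assms(3) by blast
    with L_val[of s] d_le[of s] show ?thesis by (simp add: d_def)
  qed
  define Y where "Y = {s. d s = m}"
  have "m \<in> range d"
    unfolding m_def by (rule Max_in) auto
  then have Y_ne: "Y \<noteq> {}"
    by (auto simp: Y_def)
  \<comment> \<open>On the target \<open>L\<close> is 1 and bounds \<open>U\<close>; on value-zero
    states \<open>U\<close> is 0. The gap is nonpositive in both cases, whereas \<open>m\<close> is
    positive.\<close>
  have Y_disj: "Y \<subseteq> - (target G \<union> zero_states G)"
  proof -
    have "d s \<le> 0" if "s \<in> target G" for s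
      using upper_limit_le_1[OF G W, of s] L_target[OF that] by (simp add: d_def)
    moreover have "d s \<le> 0" if "s \<in> zero_states G" for s
      using upper_limit_zero[OF G W that] L0[of s] by (simp add: d_def)
    ultimately show ?thesis
      using \<open>0 < m\<close> by (force simp: Y_def)
  qed
  obtain \<rho> where \<rho>: "\<And>s. \<rho> s \<in> local1 G s" "\<And>s. guaranteed G ?U s (\<rho> s) = bellman G ?U s"
    and \<rho>_max: "\<And>s \<rho>'. \<rho>' \<in> local1 G s \<Longrightarrow> guaranteed G ?U s \<rho>' = bellman G ?U s
      \<Longrightarrow> set_pmf \<rho>' \<subseteq> set_pmf (\<rho> s)"
    by (rule max_support_optimal_strategy[OF G, of ?U]) blast
  \<comment> \<open>The reply is chosen for \<open>L\<close>, not for \<open>U\<close>: it keeps the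
    expectation of \<open>L\<close> low, while the optimal \<rho> already protects the expectation
    of \<open>U\<close> against every reply.\<close>
  have "\<exists>\<sigma>. \<sigma> \<in> local2 G s \<and> bellman_at G L s (\<rho> s) \<sigma> = guaranteed G L s (\<rho> s)" for s
    by (rule guaranteed_attained[OF G, of s L "\<rho> s"]) blast
  then have "\<forall>s. \<exists>\<sigma>. \<sigma> \<in> local2 G s \<and> bellman_at G L s (\<rho> s) \<sigma> = guaranteed G L s (\<rho> s)"
    by (rule allI)
  from choice[OF this] obtain \<sigma> where
    "\<forall>s. \<sigma> s \<in> local2 G s \<and> bellman_at G L s (\<rho> s) (\<sigma> s) = guaranteed G L s (\<rho> s)"
    by (rule exE)
  then have \<sigma>: "\<And>s. \<sigma> s \<in> local2 G s"
      "\<And>s. bellman_at G L s (\<rho> s) (\<sigma> s) = guaranteed G L s (\<rho> s)"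
    by simp_all
  have "Post G s (\<rho> s) (\<sigma> s) \<subseteq> Y" if s: "s \<in> Y" for s
  proof
    fix s' assume s': "s' \<in> Post G s (\<rho> s) (\<sigma> s)"
    have "s \<notin> target G"
      using s Y_disj by blast
    then have "bellman_at G L s (\<rho> s) (\<sigma> s) \<le> L s"
      using guaranteed_le_bellman[OF G \<rho>(1)[of s], of L] L_super[of s] \<sigma>(2)[of s] by simp
    moreover have "?U s \<le> bellman_at G ?U s (\<rho> s) (\<sigma> s)"
      using guaranteed_le[OF \<sigma>(1)[of s], of ?U "\<rho> s"] upper_limit_le_bellman[OF G W, of s] \<rho>(2)[of s]
      by simp
    moreover have "m = ?U s - L s"
      using s by (simp add: Y_def d_def)
    \<comment> \<open>The expected gap after the move is at least the maximal gap \<open>m\<close>,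
      so every successor attains it.\<close>
    ultimately have "m \<le> bellman_at G d s (\<rho> s) (\<sigma> s)"
      using bellman_at_diff[of G ?U L s "\<rho> s" "\<sigma> s"] by (simp add: d_def[abs_def])
    then show "s' \<in> Y"
      using bellman_at_stable_set[OF d_le _ s'] by (simp add: Y_def)
  qed
  with Y_ne obtain X where X: "X \<subseteq> Y" "X \<noteq> {}" "\<And>s. s \<in> X \<Longrightarrow> Post G s (\<rho> s) (\<sigma> s) \<subseteq> X"
    "\<And>s t. s \<in> X \<Longrightarrow> t \<in> X \<Longrightarrow>
       (s, t) \<in> {(u, u'). u \<in> X \<and> u' \<in> X \<and> u' \<in> Post G u (\<rho> u) (\<sigma> u)}\<^sup>*"
    by (rule ex_bottom_component[of Y "\<lambda>s. Post G s (\<rho> s) (\<sigma> s)"]) blast+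
  have "end_component G X"
    unfolding end_component_def using X \<rho>(1) \<sigma>(1)
    by (intro conjI exI[of _ \<rho>] exI[of _ \<sigma>] ballI) auto
  moreover have "\<rho> s \<in> hazard G ?U X s" if s: "s \<in> X" for s
    unfolding hazard_def
  proof (intro CollectI conjI)
    show "\<rho> s \<in> local1 G s" by (rule \<rho>(1))
    show "\<rho> s \<in> non_leaving G X s"
      using X(3)[OF s] \<rho>(1) \<sigma>(1) by (auto simp: non_leaving_def leaving_def leaves_def)
    have opt: "guaranteed G ?U s \<rho>' \<le> guaranteed G ?U s (\<rho> s)" if "\<rho>' \<in> local1 G s" for \<rho>'
      using guaranteed_le_bellman[OF G that] by (simp add: \<rho>(2))
    then show "weakly_dominated G ?U s (local2 G s) (local1 G s - {\<rho> s}) {\<rho> s}"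
      by (simp add: weakly_dominated_def guaranteed_def)
    have "\<exists>\<sigma>'\<in>local2 G s. bellman_at G ?U s \<rho>' \<sigma>' < bellman_at G ?U s (\<rho> s) \<sigma>'"
      if \<rho>': "\<rho>' \<in> leaving G X s" for \<rho>'
    proof -
      have \<rho>'_local: "\<rho>' \<in> local1 G s" and "\<not> Post G s \<rho>' (\<sigma> s) \<subseteq> X"
        using \<rho>' \<sigma>(1) by (auto simp: leaving_def leaves_def)
      \<comment> \<open>Against \<open>\<sigma> s\<close> the actions in the support of
        \<open>\<rho> s\<close> stay in \<open>X\<close>, so \<rho>' must use an action outside it.
        By maximality of that support, \<rho>' is not optimal.\<close>
      then have "\<not> set_pmf \<rho>' \<subseteq> set_pmf (\<rho> s)"
        using Post_mono[of \<rho>' "\<rho> s" G s "\<sigma> s"] X(3)[OF s] by blast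
      then have less: "guaranteed G ?U s \<rho>' < guaranteed G ?U s (\<rho> s)"
        using \<rho>_max[OF \<rho>'_local] opt[OF \<rho>'_local] \<rho>(2) by (force simp: less_le)
      \<comment> \<open>A best reply to \<rho>' witnesses strictness: \<rho>' gets exactly its
        guarantee there, and \<open>\<rho> s\<close> gets at least its own, larger one.\<close>
      obtain \<sigma>' where "\<sigma>' \<in> local2 G s" "bellman_at G ?U s \<rho>' \<sigma>' = guaranteed G ?U s \<rho>'"
        by (rule guaranteed_attained[OF G])
      with less guaranteed_le[of \<sigma>' G s ?U "\<rho> s"] show ?thesis
        by (intro bexI[of _ \<sigma>']) auto
    qed
    then show "strictly_dominated G ?U s (local2 G s) (leaving G X s) {\<rho> s}"
      using opt by (auto simp: strictly_dominated_def guaranteed_def leaving_def)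
  qed
  ultimately have "bloated_end_component G ?U X"
    unfolding bloated_end_component_def using X(1) Y_disj by blast
  then show ?thesis
    by (auto simp: bloated_end_component_def)
qed

end
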